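(* For every BPPS instance, the LP relaxation of the arc-flow formulation $\mathrm{ILP}_{\mathrm{AF}}$ is at least as strong as the LP relaxation of the natural compact formulation $\mathrm{ILP}_{\mathrm N}$, i.e. $$\zeta(\mathrm{LP}_{\mathrm{AF}})\ \ge\ \zeta(\mathrm{LP}_{\mathrm N}).$$
   Context: **BPPS.** An instance of the Bin Packing Problem with Setups consists of: a bin capacity $d\in\mathbb Z_{\ge1}$; items $\mathcal I=\{1,\dots,n\}$ with weights $w_i\in\mathbb Z_{\ge1}$; classes $\mathcal C=\{1,\dots,m\}$ and a partition $\{\mathcal I_1,\dots,\mathcal I_m\}$ of $\mathcal I$ into (nonempty) classes; for each class $c$ a setup weight $s_c\in\mathbb Z_{\ge0}$ and a setup cost $f_c\in\mathbb Z_{\ge0}$; a bin cost $r\in\mathbb Z_{\ge1}$. It is assumed that $w_i+s_c\le d$ for all $c\in\mathcal C$, $i\in\mathcal I_c$, and that the items cannot all be packed in a single bin, i.e. $\sum_{i\in\mathcal I}w_i+\sum_{c\in\mathcal C}s_c>d$. For $S\subseteq\mathcal I$ let $\mathcal C(S)=\{c\in\mathcal C: S\cap\mathcal I_c\neq\emptyset\}$. A packing pattern is a subset $S\subseteq\mathcal I$ with $\sum_{i\in S}w_i+\sum_{c\in\mathcal C(S)}s_c\le d$. A feasible solution is a partition $\mathcal S$ of $\mathcal I$ into (nonempty) packing patterns (used bins); its cost is $r|\mathcal S|+\sum_{S\in\mathcal S}\sum_{c\in\mathcal C(S)}f_c$, to be minimized. **Natural formulation.** Let $k\in\mathbb Z_{\ge1}$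 be an upper bound on the number of bins used in any optimal BPPS solution and $\mathcal B=\{1,\dots,k\}$. $\mathrm{LP}_{\mathrm N}$ (the LP relaxation of $\mathrm{ILP}_{\mathrm N}$, which has the same constraints with binary variables) is: minimize $\sum_{b\in\mathcal B}\big(r z_b+\sum_{c\in\mathcal C}f_c y_{cb}\big)$ subject to $\sum_{b\in\mathcal B}x_{ib}=1$ ($i\in\mathcal I$); $\sum_{i\in\mathcal I}w_ix_{ib}+\sum_{c\in\mathcal C}s_cy_{cb}\le d\,z_b$ ($b\in\mathcal B$); $x_{ib}\le y_{cb}$ ($c\in\mathcal C$, $i\in\mathcal I_c$, $b\in\mathcal B$); all $x_{ib},y_{cb},z_b\in[0,1]$. Its optimal value is $\zeta(\mathrm{LP}_{\mathrm N})$. **DAG construction.** Vertices other than the sink $\tau$ are triples $(\ell,t,e)$ with load $\ell\in\{0,\dots,d\}$, stage $t\in\mathbb Z_{\ge0}$ and flag $e\in\{-1,0,1\}$; only vertices generated by the following rules exist. The source is $\sigma=(0,0,-1)$. Each arc $a$ has a weight $\omega_a$ and a cost $\lambda_a$. Classes are processed in a fixed order, starting with $t_{\mathrm{prev}}=0$ (entry/exit layer $\{\sigma\}$). For class $c$, put $t_{\mathrm{exit}}=t_{\mathrm{prev}}+|\mathcal I_c|+2$, and: 1. from each vertex $(\ell,t_{\mathrm{prev}},-1)$ add a bypass arc (weight 0, cost 0) to $(\ell,t_{\mathrm{exit}},-1)$; 2. from each vertex $(\ell,t_{\mathrm{prev}},-1)$ with $\ell+s_c\le d$ add a setup arc of class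 $c$ (weight $s_c$, cost $f_c$) to $(\ell+s_c,t_{\mathrm{prev}}+1,0)$; 3. process the items of $\mathcal I_c$ in non-increasing order of weight, starting from stage $t=t_{\mathrm{prev}}+1$ and increasing $t$ by one after each item; for item $i$ and every vertex $(\ell,t,e)$ at the current stage $t$, add a bypass arc (weight 0, cost 0) to $(\ell,t+1,e)$ and, if $\ell+w_i\le d$, an item arc of item $i$ (weight $w_i$, cost 0) to $(\ell+w_i,t+1,1)$; 4. from each vertex $(\ell,t_{\mathrm{exit}}-1,1)$ add a bypass arc (weight 0, cost 0) to $(\ell,t_{\mathrm{exit}},-1)$; vertices $(\ell,t_{\mathrm{exit}}-1,0)$ receive no outgoing arc. Then set $t_{\mathrm{prev}}:=t_{\mathrm{exit}}$ and go to the next class. After the last class, each vertex of the final entry/exit layer with load $\ell\ge1$ gets a loss arc (weight 0, cost $r$) to $\tau$. Finally, all vertices from which $\tau$ is not reachable, and their incident arcs, are removed. **DAG compression.** Two steps. In Step 1, for each vertex $u$ let $\phi(u,\tau)$ be the maximum total weight of a path from $u$ to $\tau$; merge two vertices if and only if they have the same stage and the same value of $\phi(\cdot,\tau)$. In Step 2, on the resulting DAG, let $\phi(\sigma,u)$ be the maximum total weight of a path from $\sigma$ to $u$; merge two vertices if and only if they have the same stage and the same value of $\phi(\sigma,\cdot)$. The sink $\tau$ has its own stage (so it is not merged with any other vertex), and the flag $e$ plays no role in merging. Arcs are inherited by the merged vertices, keeping their type (setup arc of class $c$, item arc of item $i$, bypass, loss), weight and cost; parallel arcs of different types are kept distinct,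 and identical parallel arcs are identified. Let $\mathcal G=(\mathcal V,\mathcal A)$ be the resulting compressed DAG, and let $\mathcal A_{\mathcal I}(i)\subseteq\mathcal A$ be the set of item arcs of item $i$. **Arc-flow formulation.** $\mathrm{ILP}_{\mathrm{AF}}$ is: minimize $\sum_{a\in\mathcal A}\lambda_a\varphi_a$ subject to $\sum_{a\in\delta^-(v)}\varphi_a-\sum_{a\in\delta^+(v)}\varphi_a=0$ for all $v\in\mathcal V\setminus\{\sigma,\tau\}$; $\sum_{a\in\mathcal A_{\mathcal I}(i)}\varphi_a=1$ for all $i\in\mathcal I$; $\varphi_a\in\mathbb Z_{\ge0}$ for all $a\in\mathcal A$, where $\delta^-(v),\delta^+(v)$ are the sets of arcs entering and leaving $v$. $\mathrm{LP}_{\mathrm{AF}}$ is its LP relaxation (integrality replaced by $\varphi_a\ge0$) and $\zeta(\mathrm{LP}_{\mathrm{AF}})$ its optimal objective function value. *)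

theory Defs
  imports Complex_Main "HOL-Library.Disjoint_Sets" "HOL-Library.Extended_Real"
begin

section \<open>The bin packing problem with setups\<close>

record bpps =
  capacity :: nat
  num_items :: nat
  num_classes :: nat
  item_weight :: "nat \<Rightarrow> nat"
  members :: "nat \<Rightarrow> nat set"
  setup_weight :: "nat \<Rightarrow> nat"
  setup_cost :: "nat \<Rightarrow> nat"
  bin_cost :: nat

definition items :: "bpps \<Rightarrow> nat set" where
  "items P = {1..num_items P}"

definition classes :: "bpps \<Rightarrow> nat set" where
  "classes P = {1..num_classes P}"

definition bpps_instance :: "bpps \<Rightarrow> bool" where
  "bpps_instance P \<longleftrightarrow>
     capacity P \<ge> 1 \<and> bin_cost P \<ge> 1 \<and>
     (\<forall>i\<in>items P. item_weight P i \<ge> 1) \<and>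
     (\<forall>c\<in>classes P. members P c \<noteq> {}) \<and>
     disjoint_family_on (members P) (classes P) \<and>
     (\<Union>c\<in>classes P. members P c) = items P \<and>
     (\<forall>c\<in>classes P. \<forall>i\<in>members P c. item_weight P i + setup_weight P c \<le> capacity P) \<and>
     (\<Sum>i\<in>items P. item_weight P i) + (\<Sum>c\<in>classes P. setup_weight P c) > capacity P"

definition classes_of :: "bpps \<Rightarrow> nat set \<Rightarrow> nat set" where
  "classes_of P S = {c \<in> classes P. S \<inter> members P c \<noteq> {}}"

definition packing_pattern :: "bpps \<Rightarrow> nat set \<Rightarrow> bool" where
  "packing_pattern P S \<longleftrightarrow> S \<subseteq> items P \<and>
     (\<Sum>i\<in>S. item_weight P i) + (\<Sum>c\<in>classes_of P S. setup_weight P c) \<le> capacity P"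

definition feasible_solution :: "bpps \<Rightarrow> nat set set \<Rightarrow> bool" where
  "feasible_solution P \<S> \<longleftrightarrow> partition_on (items P) \<S> \<and> (\<forall>S\<in>\<S>. packing_pattern P S)"

definition solution_cost :: "bpps \<Rightarrow> nat set set \<Rightarrow> nat" where
  "solution_cost P \<S> = bin_cost P * card \<S> + (\<Sum>S\<in>\<S>. \<Sum>c\<in>classes_of P S. setup_cost P c)"

definition optimal_solution :: "bpps \<Rightarrow> nat set set \<Rightarrow> bool" where
  "optimal_solution P \<S> \<longleftrightarrow> feasible_solution P \<S> \<and>
     (\<forall>\<T>. feasible_solution P \<T> \<longrightarrow> solution_cost P \<S> \<le> solution_cost P \<T>)"

definition bin_upper_bound :: "bpps \<Rightarrow> nat \<Rightarrow> bool" where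
  "bin_upper_bound P k \<longleftrightarrow> k \<ge> 1 \<and> (\<forall>\<S>. optimal_solution P \<S> \<longrightarrow> card \<S> \<le> k)"


section \<open>Natural formulation\<close>

text \<open>Optimal values of linear programs are taken in the extended reals, so that an infeasible
  minimization problem has value \<open>\<infinity>\<close> and an unbounded one has value \<open>-\<infinity>\<close>.\<close>

definition min_value :: "'a set \<Rightarrow> ('a \<Rightarrow> real) \<Rightarrow> ereal" where
  "min_value X obj = (INF v\<in>X. ereal (obj v))"

type_synonym nat_vars = "(nat \<Rightarrow> nat \<Rightarrow> real) \<times> (nat \<Rightarrow> nat \<Rightarrow> real) \<times> (nat \<Rightarrow> real)"

definition lp_nat_feasible :: "bpps \<Rightarrow> nat \<Rightarrow> nat_vars set" where
  "lp_nat_feasible P k = {(x, y, z).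
     (\<forall>i\<in>items P. (\<Sum>b\<in>{1..k}. x i b) = 1) \<and>
     (\<forall>b\<in>{1..k}. (\<Sum>i\<in>items P. real (item_weight P i) * x i b)
                + (\<Sum>c\<in>classes P. real (setup_weight P c) * y c b) \<le> real (capacity P) * z b) \<and>
     (\<forall>c\<in>classes P. \<forall>i\<in>members P c. \<forall>b\<in>{1..k}. x i b \<le> y c b) \<and>
     (\<forall>i\<in>items P. \<forall>b\<in>{1..k}. x i b \<in> {0..1}) \<and>
     (\<forall>c\<in>classes P. \<forall>b\<in>{1..k}. y c b \<in> {0..1}) \<and>
     (\<forall>b\<in>{1..k}. z b \<in> {0..1})}"

definition lp_nat_cost :: "bpps \<Rightarrow> nat \<Rightarrow> nat_vars \<Rightarrow> real" where
  "lp_nat_cost P k = (\<lambda>(x, y, z).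
     \<Sum>b\<in>{1..k}. real (bin_cost P) * z b + (\<Sum>c\<in>classes P. real (setup_cost P c) * y c b))"

definition lp_nat_value :: "bpps \<Rightarrow> nat \<Rightarrow> ereal" where
  "lp_nat_value P k = min_value (lp_nat_feasible P k) (lp_nat_cost P k)"


section \<open>Layered networks\<close>

text \<open>An arc is a triple of tail, type and head. Its weight and cost are determined by its type, so
  parallel arcs are distinct exactly when their types differ.\<close>

datatype arc_type = Bypass | Setup nat | Item nat | Loss

type_synonym 'v arc = "'v \<times> arc_type \<times> 'v"

definition arc_weight :: "bpps \<Rightarrow> 'v arc \<Rightarrow> nat" where
  "arc_weight P = (\<lambda>(u, a, v).
     case a of Bypass \<Rightarrow> 0 | Setup c \<Rightarrow> setup_weight P c | Item i \<Rightarrow> item_weight P i | Loss \<Rightarrow> 0)"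

definition arc_cost :: "bpps \<Rightarrow> 'v arc \<Rightarrow> nat" where
  "arc_cost P = (\<lambda>(u, a, v).
     case a of Bypass \<Rightarrow> 0 | Setup c \<Rightarrow> setup_cost P c | Item i \<Rightarrow> 0 | Loss \<Rightarrow> bin_cost P)"

text \<open>The stage \<open>None\<close> is reserved for the sink.\<close>

record 'v network =
  verts :: "'v set"
  arcs :: "'v arc set"
  source :: 'v
  sink :: 'v
  stage :: "'v \<Rightarrow> nat option"

fun is_path :: "'v network \<Rightarrow> 'v \<Rightarrow> 'v arc list \<Rightarrow> 'v \<Rightarrow> bool" where
  "is_path G u [] v \<longleftrightarrow> u \<in> verts G \<and> u = v"
| "is_path G u (a # p) v \<longleftrightarrow> a \<in> arcs G \<and> fst a = u \<and> is_path G (snd (snd a)) p v"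

definition max_path_weight :: "bpps \<Rightarrow> 'v network \<Rightarrow> 'v \<Rightarrow> 'v \<Rightarrow> nat" where
  "max_path_weight P G u v = Max {\<Sum>a\<leftarrow>p. arc_weight P a |p. is_path G u p v}"


section \<open>DAG construction\<close>

text \<open>The processing order is given by a list \<open>cs\<close> of the classes and, for each class \<open>c\<close>, a list
  \<open>io c\<close> of its items.\<close>

definition class_order :: "bpps \<Rightarrow> nat list \<Rightarrow> bool" where
  "class_order P cs \<longleftrightarrow> distinct cs \<and> set cs = classes P"

definition item_order :: "bpps \<Rightarrow> (nat \<Rightarrow> nat list) \<Rightarrow> bool" where
  "item_order P io \<longleftrightarrow> (\<forall>c\<in>classes P. distinct (io c) \<and> set (io c) = members P c \<and>
     sorted_wrt (\<lambda>i j. item_weight P i \<ge> item_weight P j) (io c))"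

text \<open>\<open>Node l t e\<close> has load \<open>l\<close>, stage \<open>t\<close> and flag \<open>e\<close>.\<close>

datatype vertex = Node nat nat int | Sink

fun vertex_stage :: "vertex \<Rightarrow> nat option" where
  "vertex_stage (Node l t e) = Some t"
| "vertex_stage Sink = None"

text \<open>\<open>entry P cs j\<close> is the stage of the entry layer of the \<open>j\<close>-th class (counting from 0), which is
  also the exit layer of its predecessor.\<close>

definition entry :: "bpps \<Rightarrow> nat list \<Rightarrow> nat \<Rightarrow> nat" where
  "entry P cs j = (\<Sum>c\<leftarrow>take j cs. card (members P c) + 2)"

inductive raw_vertex :: "bpps \<Rightarrow> nat list \<Rightarrow> (nat \<Rightarrow> nat list) \<Rightarrow> vertex \<Rightarrow> bool"
  and raw_arc :: "bpps \<Rightarrow> nat list \<Rightarrow> (nat \<Rightarrow> nat list) \<Rightarrow> vertex \<Rightarrow> arc_type \<Rightarrow> vertex \<Rightarrow> bool"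
  for P :: bpps and cs :: "nat list" and io :: "nat \<Rightarrow> nat list"
where
  source: "raw_vertex P cs io (Node 0 0 (-1))"
| head: "raw_arc P cs io u a v \<Longrightarrow> raw_vertex P cs io v"
| skip_class: "\<lbrakk>j < length cs; raw_vertex P cs io (Node l (entry P cs j) (-1))\<rbrakk> \<Longrightarrow>
    raw_arc P cs io (Node l (entry P cs j) (-1)) Bypass (Node l (entry P cs (Suc j)) (-1))"
| setup_class: "\<lbrakk>j < length cs; raw_vertex P cs io (Node l (entry P cs j) (-1));
      l + setup_weight P (cs ! j) \<le> capacity P\<rbrakk> \<Longrightarrow>
    raw_arc P cs io (Node l (entry P cs j) (-1)) (Setup (cs ! j))
      (Node (l + setup_weight P (cs ! j)) (entry P cs j + 1) 0)"
| skip_item: "\<lbrakk>j < length cs; q < length (io (cs ! j)); t = entry P cs j + 1 + q;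
      raw_vertex P cs io (Node l t e)\<rbrakk> \<Longrightarrow>
    raw_arc P cs io (Node l t e) Bypass (Node l (t + 1) e)"
| item: "\<lbrakk>j < length cs; q < length (io (cs ! j)); t = entry P cs j + 1 + q;
      raw_vertex P cs io (Node l t e); i = io (cs ! j) ! q;
      l + item_weight P i \<le> capacity P\<rbrakk> \<Longrightarrow>
    raw_arc P cs io (Node l t e) (Item i) (Node (l + item_weight P i) (t + 1) 1)"
| exit_class: "\<lbrakk>j < length cs; t + 1 = entry P cs (Suc j); raw_vertex P cs io (Node l t 1)\<rbrakk> \<Longrightarrow>
    raw_arc P cs io (Node l t 1) Bypass (Node l (t + 1) (-1))"
| loss: "\<lbrakk>raw_vertex P cs io (Node l (entry P cs (length cs)) (-1)); l \<ge> 1\<rbrakk> \<Longrightarrow>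
    raw_arc P cs io (Node l (entry P cs (length cs)) (-1)) Loss Sink"

definition raw_dag :: "bpps \<Rightarrow> nat list \<Rightarrow> (nat \<Rightarrow> nat list) \<Rightarrow> vertex network" where
  "raw_dag P cs io = \<lparr>
     verts = {v. raw_vertex P cs io v},
     arcs = {(u, a, v). raw_arc P cs io u a v},
     source = Node 0 0 (-1), sink = Sink, stage = vertex_stage\<rparr>"

definition prune :: "'v network \<Rightarrow> 'v network" where
  "prune G = (let V = {v \<in> verts G. \<exists>p. is_path G v p (sink G)} in
     G\<lparr>verts := V, arcs := {(u, a, v) \<in> arcs G. u \<in> V \<and> v \<in> V}\<rparr>)"

definition dag :: "bpps \<Rightarrow> nat list \<Rightarrow> (nat \<Rightarrow> nat list) \<Rightarrow> vertex network" where
  "dag P cs io = prune (raw_dag P cs io)"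


section \<open>DAG compression\<close>

text \<open>\<open>merge_by \<phi> G\<close> identifies two vertices iff they agree in both stage and \<open>\<phi>\<close>; the merged vertex
  is named by this common pair, and arcs with the same merged end points and the same type are
  identified.\<close>

definition merge_by :: "('v \<Rightarrow> nat) \<Rightarrow> 'v network \<Rightarrow> (nat option \<times> nat) network" where
  "merge_by \<phi> G = (let key = (\<lambda>u. (stage G u, \<phi> u)) in \<lparr>
     verts = key ` verts G,
     arcs = (\<lambda>(u, a, v). (key u, a, key v)) ` arcs G,
     source = key (source G), sink = key (sink G), stage = fst\<rparr>)"

definition compress_to_sink :: "bpps \<Rightarrow> 'v network \<Rightarrow> (nat option \<times> nat) network" where
  "compress_to_sink P G = merge_by (\<lambda>u. max_path_weight P G u (sink G)) G"

definition compress_from_source :: "bpps \<Rightarrow> 'v network \<Rightarrow> (nat option \<times> nat) network" where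
  "compress_from_source P G = merge_by (\<lambda>u. max_path_weight P G (source G) u) G"

definition compressed_dag ::
    "bpps \<Rightarrow> nat list \<Rightarrow> (nat \<Rightarrow> nat list) \<Rightarrow> (nat option \<times> nat) network" where
  "compressed_dag P cs io = compress_from_source P (compress_to_sink P (dag P cs io))"


section \<open>Arc-flow formulation\<close>

definition arcs_in :: "'v network \<Rightarrow> 'v \<Rightarrow> 'v arc set" where
  "arcs_in G v = {a \<in> arcs G. snd (snd a) = v}"

definition arcs_out :: "'v network \<Rightarrow> 'v \<Rightarrow> 'v arc set" where
  "arcs_out G v = {a \<in> arcs G. fst a = v}"

definition item_arcs :: "'v network \<Rightarrow> nat \<Rightarrow> 'v arc set" where
  "item_arcs G i = {a \<in> arcs G. fst (snd a) = Item i}"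

definition lp_af_feasible :: "bpps \<Rightarrow> 'v network \<Rightarrow> ('v arc \<Rightarrow> real) set" where
  "lp_af_feasible P G = {\<phi>.
     (\<forall>v\<in>verts G - {source G, sink G}.
        (\<Sum>a\<in>arcs_in G v. \<phi> a) - (\<Sum>a\<in>arcs_out G v. \<phi> a) = 0) \<and>
     (\<forall>i\<in>items P. (\<Sum>a\<in>item_arcs G i. \<phi> a) = 1) \<and>
     (\<forall>a\<in>arcs G. \<phi> a \<ge> 0)}"

definition lp_af_cost :: "bpps \<Rightarrow> 'v network \<Rightarrow> ('v arc \<Rightarrow> real) \<Rightarrow> real" where
  "lp_af_cost P G \<phi> = (\<Sum>a\<in>arcs G. real (arc_cost P a) * \<phi> a)"

definition lp_af_value :: "bpps \<Rightarrow> 'v network \<Rightarrow> ereal" where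
  "lp_af_value P G = min_value (lp_af_feasible P G) (lp_af_cost P G)"

end

theory Submission
  imports Defs
begin

text \<open>The natural relaxation always admits the uniform solution \<open>x = y = 1 / k\<close> of cost
  \<open>r (W + S) / d + F\<close>, where \<open>W\<close>, \<open>S\<close>, \<open>F\<close> are the total item weight, setup weight and setup cost; the
  bound \<open>z \<le> 1\<close> holds because the bins of an optimal solution provide total capacity at least
  \<open>W + S\<close>. Conversely, every feasible arc flow costs at least this much, which is shown by testing flow
  conservation against two kinds of potentials. The indicator of the stages between the setup arcs of
  a class and one of its items shows that at least one unit of flow uses these setup arcs. The maximum
  path weight from the source, by which the compressed vertices are named, grows along each arc by at
  least the weight of the arc and never exceeds \<open>d\<close>; hence the flow into the sink, times \<open>d\<close>, is at
  least the total weight \<open>W + S\<close> carried by the flow.\<close>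

section \<open>Networks and potentials\<close>

definition wf_network :: "'v network \<Rightarrow> bool" where
  "wf_network G \<longleftrightarrow> finite (verts G) \<and> finite (arcs G) \<and>
     (\<forall>(u, a, v)\<in>arcs G. u \<in> verts G \<and> v \<in> verts G)"

text \<open>This notion serves twice: a bounded potential makes the maximum in
  \<open>max_path_weight\<close> one over a finite set, and on the compressed network it is the dual
  certificate for the number of bins.\<close>

definition load_potential :: "bpps \<Rightarrow> 'v network \<Rightarrow> ('v \<Rightarrow> nat) \<Rightarrow> bool" where
  "load_potential P G h \<longleftrightarrow> (\<forall>v\<in>verts G. h v \<le> capacity P) \<and>
     (\<forall>(u, a, v)\<in>arcs G. h u + arc_weight P (u, a, v) \<le> h v)"

lemma is_path_end_in_verts: "is_path G u p v \<Longrightarrow> v \<in> verts G"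
  by (induction p arbitrary: u) auto

lemma is_path_append:
  "is_path G u p v \<Longrightarrow> is_path G v q w \<Longrightarrow> is_path G u (p @ q) w"
  by (induction p arbitrary: u) auto

lemma is_path_start_in_verts: "wf_network G \<Longrightarrow> is_path G u p v \<Longrightarrow> u \<in> verts G"
  by (cases p) (auto simp: wf_network_def)

text \<open>Every vertex of such a path reaches the sink by following the rest of \<open>p\<close>
  and then \<open>q\<close>, so pruning removes none of its vertices or arcs.\<close>

lemma is_path_prune:
  assumes "wf_network G" "is_path G u p v" "is_path G v q (sink G)"
  shows "is_path (prune G) u p v"
  using assms(2)
proof (induction p arbitrary: u)
  case Nil
  then show ?case using assms by (auto simp: prune_def Let_def)
next
  case (Cons e p)
  obtain a w where e: "e = (u, a, w)" using Cons.prems by (cases e) auto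
  have paths: "is_path G w (p @ q) (sink G)" "is_path G u ((e # p) @ q) (sink G)"
    using Cons.prems assms(3) e by (auto intro: is_path_append)
  have "u \<in> verts G" "w \<in> verts G"
    using paths is_path_start_in_verts[OF assms(1)] by blast+
  with paths have "u \<in> verts (prune G)" "w \<in> verts (prune G)"
    unfolding prune_def Let_def by (simp, blast)+
  then have "e \<in> arcs (prune G)"
    using Cons.prems e by (auto simp: prune_def Let_def)
  then show ?case using Cons e by auto
qed

lemma is_path_merge_by:
  fixes \<phi> :: "'v \<Rightarrow> nat"
  defines "key \<equiv> \<lambda>G u. (stage G u, \<phi> u)"
  assumes "is_path G u p v"
  shows "is_path (merge_by \<phi> G) (key G u) (map (\<lambda>(u, a, v). (key G u, a, key G v)) p) (key G v)"
  using assms(2)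
  by (induction p arbitrary: u) (force simp: merge_by_def Let_def key_def)+

lemma wf_network_prune: "wf_network G \<Longrightarrow> wf_network (prune G)"
  by (auto simp: wf_network_def prune_def Let_def elim: rev_finite_subset)

lemma wf_network_merge_by: "wf_network G \<Longrightarrow> wf_network (merge_by \<phi> G)"
  by (fastforce simp: wf_network_def merge_by_def Let_def)

lemma load_potential_path:
  assumes "load_potential P G h" "is_path G u p v"
  shows "h u + (\<Sum>a\<leftarrow>p. arc_weight P a) \<le> h v"
  using assms(2)
proof (induction p arbitrary: u)
  case (Cons e p)
  obtain a w where e: "e = (u, a, w)" using Cons.prems by (cases e) auto
  have "h u + arc_weight P e \<le> h w"
    using assms(1) Cons.prems e by (auto simp: load_potential_def)
  with Cons e show ?case by force
qed auto

lemma path_weight_le_capacity: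
  assumes "load_potential P G h" "is_path G u p v"
  shows "(\<Sum>a\<leftarrow>p. arc_weight P a) \<le> capacity P"
proof -
  have "h v \<le> capacity P"
    using assms is_path_end_in_verts by (fastforce simp: load_potential_def)
  with load_potential_path[OF assms] show ?thesis by linarith
qed

text \<open>Only the values have to be finitely many: they are natural numbers bounded by the
  capacity, so no count of paths is involved.\<close>

lemma finite_path_weights:
  assumes "load_potential P G h"
  shows "finite {\<Sum>a\<leftarrow>p. arc_weight P a |p. is_path G u p v}"
  by (rule finite_subset[of _ "{..capacity P}"]) (auto dest: path_weight_le_capacity[OF assms])

lemma max_path_weight_attained:
  assumes "load_potential P G h" "is_path G u p v"
  obtains q where "is_path G u q v" "max_path_weight P G u v = (\<Sum>a\<leftarrow>q. arc_weight P a)"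
proof -
  have "max_path_weight P G u v \<in> {\<Sum>a\<leftarrow>p. arc_weight P a |p. is_path G u p v}"
    unfolding max_path_weight_def using assms by (intro Max_in finite_path_weights) auto
  then show ?thesis using that by auto
qed

lemma max_path_weight_ge:
  assumes "load_potential P G h" "is_path G u p v"
  shows "(\<Sum>a\<leftarrow>p. arc_weight P a) \<le> max_path_weight P G u v"
  unfolding max_path_weight_def using assms by (intro Max_ge finite_path_weights) auto

lemma max_path_weight_le_capacity:
  assumes "load_potential P G h" "is_path G u p v"
  shows "max_path_weight P G u v \<le> capacity P"
  using assms by (metis max_path_weight_attained path_weight_le_capacity)

text \<open>Putting an arc in front of a heaviest path from its head gives a path from its tail. The
  remaining weight thus drops along each arc by at least the arc weight, and its complement to the
  capacity rises.\<close>

lemma load_potential_compress_to_sink: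
  assumes "load_potential P G h" and wf: "wf_network G"
    and reach: "\<And>u. u \<in> verts G \<Longrightarrow> \<exists>p. is_path G u p (sink G)"
  shows "load_potential P (compress_to_sink P G) (\<lambda>v. capacity P - snd v)"
proof -
  let ?\<phi> = "\<lambda>u. max_path_weight P G u (sink G)"
  \<comment> \<open>The second bound keeps the truncated subtraction
    \<open>capacity P - snd v\<close> exact.\<close>
  have step: "arc_weight P (u, a, v) + ?\<phi> v \<le> ?\<phi> u" "?\<phi> u \<le> capacity P"
    if "(u, a, v) \<in> arcs G" for u a v
  proof -
    have "v \<in> verts G" using wf that by (auto simp: wf_network_def)
    then obtain q where q: "is_path G v q (sink G)" "?\<phi> v = (\<Sum>a\<leftarrow>q. arc_weight P a)"
      using reach max_path_weight_attained[OF assms(1)] by metis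
    then have p: "is_path G u ((u, a, v) # q) (sink G)" using that by simp
    show "arc_weight P (u, a, v) + ?\<phi> v \<le> ?\<phi> u"
      using max_path_weight_ge[OF assms(1) p] q(2) by simp
    show "?\<phi> u \<le> capacity P"
      using max_path_weight_le_capacity[OF assms(1) p] .
  qed
  \<comment> \<open>A merged vertex carries the common value as its second component and arc weights
    depend on the type alone, so the inequality passes to the merged arcs.\<close>
  then show ?thesis
    by (fastforce simp: load_potential_def compress_to_sink_def merge_by_def Let_def arc_weight_def)
qed

text \<open>Mirror image of the step towards the sink: an arc is appended to a heaviest path ending
  in its tail.\<close>

lemma load_potential_compress_from_source:
  assumes "load_potential P G h" and wf: "wf_network G"
    and reach: "\<And>u. u \<in> verts G \<Longrightarrow> \<exists>p. is_path G (source G) p u"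
  shows "load_potential P (compress_from_source P G) snd"
proof -
  let ?\<phi> = "\<lambda>u. max_path_weight P G (source G) u"
  have le: "?\<phi> u \<le> capacity P" if "u \<in> verts G" for u
    using reach[OF that] max_path_weight_le_capacity[OF assms(1)] by blast
  have step: "?\<phi> u + arc_weight P (u, a, v) \<le> ?\<phi> v" if "(u, a, v) \<in> arcs G" for u a v
  proof -
    have uv: "u \<in> verts G" "v \<in> verts G" using wf that by (auto simp: wf_network_def)
    then obtain q where q: "is_path G (source G) q u" "?\<phi> u = (\<Sum>a\<leftarrow>q. arc_weight P a)"
      using reach max_path_weight_attained[OF assms(1)] by metis
    then have p: "is_path G (source G) (q @ [(u, a, v)]) v"
      using that uv by (intro is_path_append) auto
    show ?thesis using max_path_weight_ge[OF assms(1) p] q(2) by simp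
  qed
  show ?thesis using le step
    by (fastforce simp: load_potential_def compress_from_source_def merge_by_def Let_def
        arc_weight_def)
qed


section \<open>Flows tested against potentials\<close>

text \<open>Weights and costs depend on the type only, so total load and objective can be collected
  type by type.\<close>

definition type_flow :: "'v network \<Rightarrow> ('v arc \<Rightarrow> real) \<Rightarrow> arc_type \<Rightarrow> real" where
  "type_flow G \<phi> a = (\<Sum>e\<in>{e \<in> arcs G. fst (snd e) = a}. \<phi> e)"

text \<open>Distinct types have disjoint sets of arcs; arcs whose type lies outside \<open>T\<close>
  only add nonnegative terms on the right.\<close>

lemma sum_type_flow_le:
  fixes g :: "arc_type \<Rightarrow> real"
  assumes "finite (arcs G)" "\<And>e. e \<in> arcs G \<Longrightarrow> \<phi> e \<ge> 0" "\<And>a. g a \<ge> 0" "finite T"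
  shows "(\<Sum>a\<in>T. g a * type_flow G \<phi> a) \<le> (\<Sum>e\<in>arcs G. g (fst (snd e)) * \<phi> e)"
proof -
  have "(\<Sum>a\<in>T. g a * type_flow G \<phi> a) =
      (\<Sum>a\<in>T. \<Sum>e\<in>{e \<in> arcs G. fst (snd e) = a}. g (fst (snd e)) * \<phi> e)"
    by (simp add: type_flow_def sum_distrib_left)
  also have "\<dots> = (\<Sum>e\<in>(\<Union>a\<in>T. {e \<in> arcs G. fst (snd e) = a}). g (fst (snd e)) * \<phi> e)"
    using assms by (intro sum.UNION_disjoint[symmetric]) auto
  also have "\<dots> \<le> (\<Sum>e\<in>arcs G. g (fst (snd e)) * \<phi> e)"
    using assms by (intro sum_mono2) auto
  finally show ?thesis .
qed

text \<open>Summation by parts: regrouping the arcs by head and by tail turns the left side into a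
  sum over vertices of \<open>h\<close> times net inflow. Conservation leaves only the source and
  the sink.\<close>

lemma flow_potential:
  assumes wf: "wf_network G" and feas: "\<phi> \<in> lp_af_feasible P G"
    and src: "arcs_in G (source G) = {}" and snk: "arcs_out G (sink G) = {}"
    and h: "h (source G) \<ge> 0"
  shows "(\<Sum>e\<in>arcs G. (h (snd (snd e)) - h (fst e)) * \<phi> e)
     \<le> h (sink G) * (\<Sum>e\<in>arcs_in G (sink G). \<phi> e)"
proof -
  have fin: "finite (verts G)" "finite (arcs G)" using wf by (auto simp: wf_network_def)
  have "(\<Sum>e\<in>arcs G. h (snd (snd e)) * \<phi> e)
      = (\<Sum>v\<in>verts G. \<Sum>e\<in>arcs_in G v. h (snd (snd e)) * \<phi> e)"
    unfolding arcs_in_def using wf fin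
    by (intro sum.group[symmetric]) (auto simp: wf_network_def)
  moreover have "(\<Sum>e\<in>arcs G. h (fst e) * \<phi> e)
      = (\<Sum>v\<in>verts G. \<Sum>e\<in>arcs_out G v. h (fst e) * \<phi> e)"
    unfolding arcs_out_def using wf fin
    by (intro sum.group[symmetric]) (auto simp: wf_network_def)
  ultimately have "(\<Sum>e\<in>arcs G. (h (snd (snd e)) - h (fst e)) * \<phi> e)
      = (\<Sum>v\<in>verts G. (\<Sum>e\<in>arcs_in G v. h (snd (snd e)) * \<phi> e)
                    - (\<Sum>e\<in>arcs_out G v. h (fst e) * \<phi> e))"
    by (simp add: left_diff_distrib sum_subtractf)
  also have "\<dots> = (\<Sum>v\<in>verts G. h v * ((\<Sum>e\<in>arcs_in G v. \<phi> e) - (\<Sum>e\<in>arcs_out G v. \<phi> e)))"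
    by (intro sum.cong refl) (simp add: right_diff_distrib sum_distrib_left arcs_in_def arcs_out_def)
  also have "\<dots> \<le> (\<Sum>v\<in>verts G. if v = sink G then h (sink G) * (\<Sum>e\<in>arcs_in G (sink G). \<phi> e) else 0)"
  proof (rule sum_mono)
    fix v assume v: "v \<in> verts G"
    \<comment> \<open>For the source: no arc enters it, so its term is minus \<open>h\<close> times
      the outflow, which is at most 0.\<close>
    have "(\<Sum>e\<in>arcs_out G v. \<phi> e) \<ge> 0"
      using feas by (intro sum_nonneg) (auto simp: lp_af_feasible_def arcs_out_def)
    then show "h v * ((\<Sum>e\<in>arcs_in G v. \<phi> e) - (\<Sum>e\<in>arcs_out G v. \<phi> e)) \<le>
        (if v = sink G then h (sink G) * (\<Sum>e\<in>arcs_in G (sink G). \<phi> e) else 0)"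
      using v feas src snk h
      by (cases "v = source G") (auto simp: lp_af_feasible_def mult_nonneg_nonneg)
  qed
  also have "\<dots> = h (sink G) * (\<Sum>e\<in>arcs_in G (sink G). \<phi> e)"
  proof (cases "sink G \<in> verts G")
    case False
    then have "arcs_in G (sink G) = {}" using wf by (fastforce simp: wf_network_def arcs_in_def)
    with False fin show ?thesis by simp
  qed (use fin in simp)
  finally show ?thesis .
qed


section \<open>The compressed network\<close>

lemma entry_Suc:
  "j < length cs \<Longrightarrow> entry P cs (Suc j) = entry P cs j + card (members P (cs ! j)) + 2"
  by (simp add: entry_def take_Suc_conv_app_nth)

lemma entry_mono: "j \<le> j' \<Longrightarrow> entry P cs j \<le> entry P cs j'"
proof (rule lift_Suc_mono_le[of "entry P cs"])
  show "entry P cs n \<le> entry P cs (Suc n)" for n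
    \<comment> \<open>Past the end of \<open>cs\<close> the prefix \<open>take n cs\<close> no
      longer changes, so \<open>entry\<close> is constant there.\<close>
    by (cases "n < length cs") (auto simp: entry_Suc, simp add: entry_def)
qed

text \<open>The capacity is the largest possible load; assigning it to the sink makes the weightless
  loss arcs respect the potential inequality.\<close>

fun vertex_load :: "bpps \<Rightarrow> vertex \<Rightarrow> nat" where
  "vertex_load P (Node l t e) = l"
| "vertex_load P Sink = capacity P"

locale ordered_bpps =
  fixes P :: bpps and cs :: "nat list" and io :: "nat \<Rightarrow> nat list"
  assumes inst: "bpps_instance P"
    and class_order: "class_order P cs"
    and item_order: "item_order P io"
begin

abbreviation G where "G \<equiv> compressed_dag P cs io"

lemma nth_class: "j < length cs \<Longrightarrow> cs ! j \<in> classes P"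
  using class_order by (metis class_order_def nth_mem)

lemma class_items:
  assumes "j < length cs"
  shows "distinct (io (cs ! j))" "set (io (cs ! j)) = members P (cs ! j)"
    "length (io (cs ! j)) = card (members P (cs ! j))"
proof -
  show d: "distinct (io (cs ! j))" "set (io (cs ! j)) = members P (cs ! j)"
    using item_order nth_class[OF assms] by (auto simp: item_order_def)
  show "length (io (cs ! j)) = card (members P (cs ! j))"
    using distinct_card[OF d(1)] d(2) by simp
qed

lemma members_subset_items: "c \<in> classes P \<Longrightarrow> members P c \<subseteq> items P"
  using inst by (auto simp: bpps_instance_def)

text \<open>Disjointness of the classes fixes the class and distinctness of the orders fixes the
  positions. Hence all arcs of an item leave from a single stage.\<close>

lemma item_position_unique:
  assumes "j < length cs" "q < length (io (cs ! j))" "j' < length cs" "q' < length (io (cs ! j'))"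
    and eq: "io (cs ! j) ! q = io (cs ! j') ! q'"
  shows "j = j' \<and> q = q'"
proof -
  have "io (cs ! j) ! q \<in> members P (cs ! j) \<inter> members P (cs ! j')"
    using assms class_items(2) by (metis IntI nth_mem)
  moreover have "disjoint_family_on (members P) (classes P)"
    using inst by (auto simp: bpps_instance_def)
  ultimately have "cs ! j = cs ! j'"
    using nth_class[OF assms(1)] nth_class[OF assms(3)] unfolding disjoint_family_on_def by blast
  then have "j = j'"
    using class_order assms(1,3) nth_eq_iff_index_eq by (metis class_order_def)
  moreover from this have "q = q'"
    using eq assms(2,4) nth_eq_iff_index_eq[OF class_items(1)[OF assms(1)]] by simp
  ultimately show ?thesis ..
qed

section \<open>Finiteness, loads and reachability in the raw DAG\<close>

lemma raw_vertex_bounds: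
  shows "raw_vertex P cs io v \<Longrightarrow> v \<in> insert Sink
     ((\<lambda>(l, t, e). Node l t e) ` ({..capacity P} \<times> {..entry P cs (length cs)} \<times> {-1, 0, 1}))"
    and "raw_arc P cs io u a v \<Longrightarrow> v \<in> insert Sink
     ((\<lambda>(l, t, e). Node l t e) ` ({..capacity P} \<times> {..entry P cs (length cs)} \<times> {-1, 0, 1}))"
proof (induction rule: raw_vertex_raw_arc.inducts)
  case (skip_class j l)
  then show ?case using entry_mono[of "Suc j" "length cs" P cs] by (auto simp: image_iff)
next
  case (setup_class j l)
  then show ?case using entry_mono[of "Suc j" "length cs" P cs] entry_Suc[of j cs P]
    by (auto simp: image_iff)
next
  case (skip_item j q t l e)
  then show ?case using entry_mono[of "Suc j" "length cs" P cs] entry_Suc[of j cs P]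
      class_items(3)[of j] by (auto simp: image_iff)
next
  case (item j q t l e i)
  then show ?case using entry_mono[of "Suc j" "length cs" P cs] entry_Suc[of j cs P]
      class_items(3)[of j] by (auto simp: image_iff)
next
  case (exit_class j t l)
  then show ?case using entry_mono[of "Suc j" "length cs" P cs] by (auto simp: image_iff)
qed (auto simp: image_iff)

lemma raw_arc_ends:
  assumes "raw_arc P cs io u a v"
  shows "raw_vertex P cs io u \<and> raw_vertex P cs io v"
proof
  show "raw_vertex P cs io u" using assms by (cases rule: raw_arc.cases) auto
  show "raw_vertex P cs io v" using assms by (rule raw_vertex_raw_arc.head)
qed

lemma raw_arc_type:
  assumes "raw_arc P cs io u a v"
  shows "a \<in> {Bypass, Loss} \<union> Setup ` classes P \<union> Item ` items P"
  using assms
proof (cases rule: raw_arc.cases)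
  case (item j q t l e i)
  then have "i \<in> items P"
    using class_items(2) nth_class members_subset_items by (metis nth_mem subsetD)
  with item show ?thesis by auto
qed (auto simp: nth_class)

lemma wf_raw_dag: "wf_network (raw_dag P cs io)"
proof -
  have fin: "finite {v. raw_vertex P cs io v}"
    by (rule finite_subset[OF subsetI[OF raw_vertex_bounds(1)]]) auto
  have "{(u, a, v). raw_arc P cs io u a v} \<subseteq> {v. raw_vertex P cs io v} \<times>
      ({Bypass, Loss} \<union> Setup ` classes P \<union> Item ` items P) \<times> {v. raw_vertex P cs io v}"
    using raw_arc_ends raw_arc_type by blast
  moreover have "finite \<dots>" using fin by (simp add: classes_def items_def)
  ultimately show ?thesis
    using fin by (auto simp: wf_network_def raw_dag_def dest: raw_arc_ends elim: finite_subset)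
qed

lemma load_potential_raw_dag: "load_potential P (raw_dag P cs io) (vertex_load P)"
proof -
  have "vertex_load P v \<le> capacity P" if "raw_vertex P cs io v" for v
    using raw_vertex_bounds(1)[OF that] by auto
  moreover have "vertex_load P u + arc_weight P (u, a, v) \<le> vertex_load P v"
    if "raw_arc P cs io u a v" for u a v
    using that
  proof (cases rule: raw_arc.cases)
    case (loss l)
    then show ?thesis using calculation raw_arc_ends[OF that] by (force simp: arc_weight_def)
  qed (auto simp: arc_weight_def)
  ultimately show ?thesis by (auto simp: load_potential_def raw_dag_def)
qed

lemma raw_dag_reachable:
  shows "raw_vertex P cs io v \<Longrightarrow> \<exists>p. is_path (raw_dag P cs io) (Node 0 0 (-1)) p v"
    and "raw_arc P cs io u a v \<Longrightarrow> \<exists>p. is_path (raw_dag P cs io) (Node 0 0 (-1)) p v"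
proof -
  \<comment> \<open>Each vertex other than the source is generated as the head of an arc, so
    extending a path by one arc settles every rule of the induction.\<close>
  have ext: "\<exists>p. is_path (raw_dag P cs io) (Node 0 0 (-1)) p v"
    if arc: "raw_arc P cs io u a v" and path: "\<exists>p. is_path (raw_dag P cs io) (Node 0 0 (-1)) p u"
    for u a v
  proof -
    obtain p where "is_path (raw_dag P cs io) (Node 0 0 (-1)) p u" using path by blast
    then have "is_path (raw_dag P cs io) (Node 0 0 (-1)) (p @ [(u, a, v)]) v"
      using arc raw_arc_ends[OF arc] by (intro is_path_append) (auto simp: raw_dag_def)
    then show ?thesis by blast
  qed
  show "raw_vertex P cs io v \<Longrightarrow> \<exists>p. is_path (raw_dag P cs io) (Node 0 0 (-1)) p v"
    and "raw_arc P cs io u a v \<Longrightarrow> \<exists>p. is_path (raw_dag P cs io) (Node 0 0 (-1)) p v"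
  proof (induction rule: raw_vertex_raw_arc.inducts)
    case source
    have "is_path (raw_dag P cs io) (Node 0 0 (-1)) [] (Node 0 0 (-1))"
      by (simp add: raw_dag_def raw_vertex_raw_arc.source)
    then show ?case by blast
  next
    case (skip_class j l)
    then show ?case by - (rule ext[OF raw_vertex_raw_arc.skip_class], assumption+)
  next
    case (setup_class j l)
    then show ?case by - (rule ext[OF raw_vertex_raw_arc.setup_class], assumption+)
  next
    case (skip_item j q t l e)
    then show ?case by - (rule ext[OF raw_vertex_raw_arc.skip_item], assumption+)
  next
    case (item j q t l e i)
    then show ?case by - (rule ext[OF raw_vertex_raw_arc.item], assumption+)
  next
    case (exit_class j t l)
    then show ?case by - (rule ext[OF raw_vertex_raw_arc.exit_class], assumption+)
  next
    case (loss l)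
    then show ?case by - (rule ext[OF raw_vertex_raw_arc.loss], assumption+)
  qed assumption
qed

section \<open>Pruning and the two merging steps\<close>

lemma wf_dag: "wf_network (dag P cs io)"
  unfolding dag_def by (intro wf_network_prune wf_raw_dag)

lemma load_potential_dag: "load_potential P (dag P cs io) (vertex_load P)"
  using load_potential_raw_dag by (auto simp: load_potential_def dag_def prune_def Let_def)

lemma dag_reaches_sink:
  assumes "u \<in> verts (dag P cs io)"
  shows "\<exists>p. is_path (dag P cs io) u p (sink (dag P cs io))"
proof -
  let ?R = "raw_dag P cs io"
  obtain p where p: "is_path ?R u p (sink ?R)"
    using assms by (auto simp: dag_def prune_def Let_def)
  then have "is_path ?R (sink ?R) [] (sink ?R)" using is_path_end_in_verts by fastforce
  from is_path_prune[OF wf_raw_dag p this] show ?thesis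
    unfolding dag_def prune_def Let_def by auto
qed

lemma dag_reachable:
  assumes "u \<in> verts (dag P cs io)"
  shows "\<exists>p. is_path (dag P cs io) (source (dag P cs io)) p u"
proof -
  let ?R = "raw_dag P cs io"
  obtain q where q: "is_path ?R u q (sink ?R)" and u: "raw_vertex P cs io u"
    using assms by (auto simp: dag_def prune_def Let_def raw_dag_def)
  obtain p where "is_path ?R (Node 0 0 (-1)) p u" using raw_dag_reachable(1)[OF u] by blast
  from is_path_prune[OF wf_raw_dag this q] show ?thesis
    unfolding dag_def by (auto simp: prune_def Let_def raw_dag_def)
qed

lemma wf_compressed_dag: "wf_network G"
  unfolding compressed_dag_def compress_from_source_def compress_to_sink_def
  by (intro wf_network_merge_by wf_dag)

text \<open>Each network supplies the bound that makes the next maximum meaningful: first the load,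
  then the complement of the remaining weight, finally the heaviest weight from the source.\<close>

lemma load_potential_compressed_dag: "load_potential P G snd"
  unfolding compressed_dag_def
proof (rule load_potential_compress_from_source)
  show "load_potential P (compress_to_sink P (dag P cs io)) (\<lambda>v. capacity P - snd v)"
    by (rule load_potential_compress_to_sink[OF load_potential_dag wf_dag dag_reaches_sink])
  show "wf_network (compress_to_sink P (dag P cs io))"
    unfolding compress_to_sink_def by (intro wf_network_merge_by wf_dag)
  fix u assume "u \<in> verts (compress_to_sink P (dag P cs io))"
  then obtain v where v: "v \<in> verts (dag P cs io)"
    "u = (stage (dag P cs io) v, max_path_weight P (dag P cs io) v (sink (dag P cs io)))"
    by (auto simp: compress_to_sink_def merge_by_def Let_def)
  obtain p where "is_path (dag P cs io) (source (dag P cs io)) p v" using dag_reachable v by blast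
  from is_path_merge_by[OF this, of "\<lambda>u. max_path_weight P (dag P cs io) u (sink (dag P cs io))"]
  show "\<exists>p. is_path (compress_to_sink P (dag P cs io))
      (source (compress_to_sink P (dag P cs io))) p u"
    unfolding compress_to_sink_def v(2) by (auto simp: merge_by_def Let_def)
qed

text \<open>Both merging steps identify only vertices of equal stage. Whatever depends on types and
  stages alone can therefore be checked on raw arcs.\<close>

lemma compressed_arc_raw:
  assumes "(u, a, v) \<in> arcs G"
  obtains u' v' where "raw_arc P cs io u' a v'" "fst u = vertex_stage u'" "fst v = vertex_stage v'"
  using assms unfolding compressed_dag_def compress_from_source_def compress_to_sink_def dag_def
  by (auto simp: merge_by_def prune_def raw_dag_def Let_def)

lemma fst_source: "fst (source G) = Some 0" and fst_sink: "fst (sink G) = None"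
  by (auto simp: compressed_dag_def compress_from_source_def compress_to_sink_def dag_def
      merge_by_def prune_def raw_dag_def Let_def)

lemma raw_arc_stages:
  assumes "raw_arc P cs io u a v"
  shows "vertex_stage v \<noteq> Some 0" "vertex_stage u \<noteq> None" "vertex_stage v = None \<Longrightarrow> a = Loss"
  using assms by (auto elim!: raw_arc.cases simp: entry_Suc)

lemma no_arcs_into_source: "arcs_in G (source G) = {}"
proof -
  have False if "(u, a, source G) \<in> arcs G" for u a
    using that by (rule compressed_arc_raw) (use raw_arc_stages fst_source in metis)
  then show ?thesis by (auto simp: arcs_in_def)
qed

lemma no_arcs_out_of_sink: "arcs_out G (sink G) = {}"
proof -
  have False if "(sink G, a, v) \<in> arcs G" for a v
    using that by (rule compressed_arc_raw) (use raw_arc_stages fst_sink in metis)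
  then show ?thesis by (auto simp: arcs_out_def)
qed

lemma arcs_into_sink: "arcs_in G (sink G) \<subseteq> {e \<in> arcs G. fst (snd e) = Loss}"
proof -
  have "a = Loss" if "(u, a, sink G) \<in> arcs G" for u a
    using that by (rule compressed_arc_raw) (use raw_arc_stages fst_sink in metis)
  then show ?thesis by (auto simp: arcs_in_def)
qed

text \<open>The window starts just after the entry layer of class \<open>j\<close> and ends at
  \<open>entry P cs j + 1 + q\<close>, the stage from which the item at position \<open>q\<close> is
  processed.\<close>

definition stage_cut :: "nat \<Rightarrow> nat \<Rightarrow> nat option \<Rightarrow> real" where
  "stage_cut j q s = (case s of None \<Rightarrow> 0
     | Some t \<Rightarrow> of_bool (entry P cs j < t \<and> t \<le> entry P cs j + 1 + q))"

text \<open>Only setup arcs of class \<open>j\<close> enter the window, since skipping the class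
  jumps over it. The arcs of the item at position \<open>q\<close> leave it; bypass arcs may leave
  it too, hence an inequality.\<close>

lemma stage_cut_raw_arc:
  assumes j: "j < length cs" and q: "q < length (io (cs ! j))" and arc: "raw_arc P cs io u a v"
  shows "stage_cut j q (vertex_stage v) - stage_cut j q (vertex_stage u) \<le>
    of_bool (a = Setup (cs ! j)) - of_bool (a = Item (io (cs ! j) ! q))"
proof -
  \<comment> \<open>The stage blocks of different classes do not overlap, so an arc of another class
    lies wholly before or after the window.\<close>
  have order: "j' = j \<or> entry P cs (Suc j') \<le> entry P cs j \<or> entry P cs (Suc j) \<le> entry P cs j'" for j'
    using entry_mono[of "Suc j'" j P cs] entry_mono[of "Suc j" j' P cs] by linarith
  note E = entry_Suc[OF j, of P] class_items(3)[OF j] q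
  from arc show ?thesis
  proof (cases rule: raw_arc.cases)
    case (skip_class j' l)
    then show ?thesis using order[of j'] entry_Suc[of j' cs P] E
      by (auto simp: stage_cut_def)
  next
    case (setup_class j' l)
    then show ?thesis using order[of j'] entry_Suc[of j' cs P] E
      by (auto simp: stage_cut_def)
  next
    case (skip_item j' q' t l e)
    then show ?thesis using order[of j'] entry_Suc[of j' cs P] class_items(3)[of j'] E
      by (auto simp: stage_cut_def)
  next
    case (item j' q' t l e i)
    then show ?thesis
      using order[of j'] entry_Suc[of j' cs P] class_items(3)[of j'] E
        \<comment> \<open>This excludes an arc of the same item elsewhere, where the right side
          would be -1 without the window being left.\<close>
        item_position_unique[OF j q, of j' q']
      by (auto simp: stage_cut_def)
  next
    case (exit_class j' t l)
    then show ?thesis using order[of j'] entry_Suc[of j' cs P] E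
      by (auto simp: stage_cut_def)
  next
    case (loss l)
    then show ?thesis by (auto simp: stage_cut_def)
  qed
qed

section \<open>Lower bounds on setup flow, loss flow and cost\<close>

lemma finite_arcs: "finite (arcs G)"
  using wf_compressed_dag by (simp add: wf_network_def)

text \<open>One unit leaves the window on the arcs of an item of the class, and it can have entered
  only on setup arcs of that class.\<close>

lemma setup_flow_ge_1:
  assumes feas: "\<phi> \<in> lp_af_feasible P G" and c: "c \<in> classes P"
  shows "type_flow G \<phi> (Setup c) \<ge> 1"
proof -
  have "c \<in> set cs" using c class_order by (simp add: class_order_def)
  then obtain j where j: "j < length cs" "c = cs ! j" by (auto simp: in_set_conv_nth)
  have "members P c \<noteq> {}" using inst c by (auto simp: bpps_instance_def)
  then have q: "0 < length (io (cs ! j))"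
    using class_items(2)[OF j(1)] j(2) by auto
  \<comment> \<open>Any item of the class would serve; the first one exists because classes are
    nonempty.\<close>
  define i where "i = io (cs ! j) ! 0"
  have "i \<in> members P c"
    using nth_mem[OF q] unfolding class_items(2)[OF j(1)] i_def j(2) .
  then have i: "i \<in> items P" using members_subset_items[OF c] by blast
  have nonneg: "\<phi> e \<ge> 0" if "e \<in> arcs G" for e
    using feas that by (auto simp: lp_af_feasible_def)
  \<comment> \<open>The sign fits the direction of \<open>flow_potential\<close>. The potential
    vanishes at the source, whose stage 0 follows no entry layer, and at the sink.\<close>
  let ?h = "\<lambda>v. - stage_cut j 0 (fst v)"
  have flow: "type_flow G \<phi> a = (\<Sum>e\<in>arcs G. of_bool (fst (snd e) = a) * \<phi> e)" for a
    unfolding type_flow_def using finite_arcs by (intro sum.mono_neutral_cong_left) auto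
  have "type_flow G \<phi> (Item i) - type_flow G \<phi> (Setup c) =
      (\<Sum>e\<in>arcs G. (of_bool (fst (snd e) = Item i) - of_bool (fst (snd e) = Setup c)) * \<phi> e)"
    by (simp add: flow left_diff_distrib sum_subtractf)
  also have "\<dots> \<le> (\<Sum>e\<in>arcs G. (?h (snd (snd e)) - ?h (fst e)) * \<phi> e)"
  proof (rule sum_mono, rule mult_right_mono[OF _ nonneg])
    fix e assume e: "e \<in> arcs G"
    obtain u a v where [simp]: "e = (u, a, v)" by (cases e)
    from e have "(u, a, v) \<in> arcs G" by simp
    then obtain u' v' where
      "raw_arc P cs io u' a v'" "fst u = vertex_stage u'" "fst v = vertex_stage v'"
      by (rule compressed_arc_raw)
    with stage_cut_raw_arc[OF j(1) q, of u' a v'] j(2)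
    show "of_bool (fst (snd e) = Item i) - of_bool (fst (snd e) = Setup c)
        \<le> ?h (snd (snd e)) - ?h (fst e)" by (simp add: i_def)
  qed
  also have "\<dots> \<le> ?h (sink G) * (\<Sum>e\<in>arcs_in G (sink G). \<phi> e)"
    by (rule flow_potential[OF wf_compressed_dag feas no_arcs_into_source no_arcs_out_of_sink])
      (simp add: fst_source stage_cut_def)
  also have "\<dots> = 0" by (simp add: fst_sink stage_cut_def)
  finally show ?thesis
    using feas i by (simp add: type_flow_def lp_af_feasible_def item_arcs_def)
qed

text \<open>Every item type carries flow 1 and every setup type at least 1, so the flow transports
  at least the total weight. Testing against the potential \<open>snd\<close> bounds that transport
  by capacity times inflow of the sink.\<close>

lemma total_weight_le_loss_flow:
  assumes feas: "\<phi> \<in> lp_af_feasible P G"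
  shows "(\<Sum>i\<in>items P. real (item_weight P i)) + (\<Sum>c\<in>classes P. real (setup_weight P c))
    \<le> real (capacity P) * type_flow G \<phi> Loss"
proof -
  have nonneg: "\<phi> e \<ge> 0" if "e \<in> arcs G" for e
    using feas that by (auto simp: lp_af_feasible_def)
  \<comment> \<open>\<open>arc_weight\<close> reads only the type, so dummy end points turn it into
    a function of types.\<close>
  let ?g = "\<lambda>a. real (arc_weight P (undefined :: unit, a, undefined))"
  let ?T = "Item ` items P \<union> Setup ` classes P"
  have fin: "finite (items P)" "finite (classes P)" by (auto simp: items_def classes_def)
  have "(\<Sum>i\<in>items P. real (item_weight P i)) + (\<Sum>c\<in>classes P. real (setup_weight P c))
      \<le> (\<Sum>i\<in>items P. real (item_weight P i) * type_flow G \<phi> (Item i)) +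
        (\<Sum>c\<in>classes P. real (setup_weight P c) * type_flow G \<phi> (Setup c))"
    using setup_flow_ge_1[OF feas] feas
    by (intro add_mono sum_mono)
      (auto simp: type_flow_def lp_af_feasible_def item_arcs_def mult_le_cancel_left1)
  also have "\<dots> = (\<Sum>a\<in>?T. ?g a * type_flow G \<phi> a)"
    using fin by (subst sum.union_disjoint) (auto simp: sum.reindex inj_on_def arc_weight_def)
  also have "\<dots> \<le> (\<Sum>e\<in>arcs G. ?g (fst (snd e)) * \<phi> e)"
    using fin nonneg by (intro sum_type_flow_le finite_arcs) auto
  also have "\<dots> \<le> (\<Sum>e\<in>arcs G. (real (snd (snd (snd e))) - real (snd (fst e))) * \<phi> e)"
  proof (rule sum_mono, rule mult_right_mono[OF _ nonneg])
    fix e assume e: "e \<in> arcs G"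
    then have "snd (fst e) + arc_weight P e \<le> snd (snd (snd e))"
      using load_potential_compressed_dag by (cases e) (auto simp: load_potential_def)
    moreover have "?g (fst (snd e)) = real (arc_weight P e)"
      by (cases e) (auto simp: arc_weight_def)
    ultimately show "?g (fst (snd e)) \<le> real (snd (snd (snd e))) - real (snd (fst e))" by linarith
  qed
  also have "\<dots> \<le> real (snd (sink G)) * (\<Sum>e\<in>arcs_in G (sink G). \<phi> e)"
    by (rule flow_potential[OF wf_compressed_dag feas no_arcs_into_source no_arcs_out_of_sink]) simp
  also have "\<dots> \<le> real (capacity P) * (\<Sum>e\<in>arcs_in G (sink G). \<phi> e)"
  proof (cases "sink G \<in> verts G")
    case True
    then have "snd (sink G) \<le> capacity P"
      using load_potential_compressed_dag by (auto simp: load_potential_def)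
    then show ?thesis
      by (intro mult_right_mono sum_nonneg) (auto simp: arcs_in_def nonneg)
  next
    \<comment> \<open>Well-formedness allows no arc into a sink that is not a vertex, so both sides
      are 0.\<close>
    case False
    then have "arcs_in G (sink G) = {}"
      using wf_compressed_dag by (fastforce simp: wf_network_def arcs_in_def)
    then show ?thesis by simp
  qed
  also have "\<dots> \<le> real (capacity P) * type_flow G \<phi> Loss"
    unfolding type_flow_def using arcs_into_sink finite_arcs nonneg
    by (intro mult_left_mono sum_mono2) auto
  finally show ?thesis .
qed

lemma lp_af_cost_ge:
  assumes feas: "\<phi> \<in> lp_af_feasible P G"
  shows "real (bin_cost P) * ((\<Sum>i\<in>items P. real (item_weight P i))
      + (\<Sum>c\<in>classes P. real (setup_weight P c))) / real (capacity P)
      + (\<Sum>c\<in>classes P. real (setup_cost P c)) \<le> lp_af_cost P G \<phi>"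
proof -
  have nonneg: "\<phi> e \<ge> 0" if "e \<in> arcs G" for e
    using feas that by (auto simp: lp_af_feasible_def)
  let ?g = "\<lambda>a. real (arc_cost P (undefined :: unit, a, undefined))"
  let ?T = "insert Loss (Setup ` classes P)"
  have fin: "finite (classes P)" by (auto simp: classes_def)
  have cap: "real (capacity P) > 0" using inst by (auto simp: bpps_instance_def)
  have "((\<Sum>i\<in>items P. real (item_weight P i)) + (\<Sum>c\<in>classes P. real (setup_weight P c)))
      / real (capacity P) \<le> type_flow G \<phi> Loss"
    using total_weight_le_loss_flow[OF feas] cap by (simp add: divide_le_eq mult.commute)
  then have "real (bin_cost P) * ((\<Sum>i\<in>items P. real (item_weight P i))
      + (\<Sum>c\<in>classes P. real (setup_weight P c))) / real (capacity P)
      + (\<Sum>c\<in>classes P. real (setup_cost P c))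
      \<le> real (bin_cost P) * type_flow G \<phi> Loss +
        (\<Sum>c\<in>classes P. real (setup_cost P c) * type_flow G \<phi> (Setup c))"
    using setup_flow_ge_1[OF feas] unfolding times_divide_eq_right[symmetric]
    by (intro add_mono mult_left_mono sum_mono) (auto simp: mult_le_cancel_left1)
  also have "\<dots> = (\<Sum>a\<in>?T. ?g a * type_flow G \<phi> a)"
    using fin by (subst sum.insert) (auto simp: sum.reindex inj_on_def arc_cost_def)
  also have "\<dots> \<le> (\<Sum>e\<in>arcs G. ?g (fst (snd e)) * \<phi> e)"
    using fin nonneg by (intro sum_type_flow_le finite_arcs) auto
  also have "\<dots> = lp_af_cost P G \<phi>"
    unfolding lp_af_cost_def by (intro sum.cong) (auto simp: arc_cost_def)
  finally show ?thesis .
qed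

end


section \<open>The natural relaxation\<close>

text \<open>\<open>bin_upper_bound\<close> speaks only of optimal solutions, so one is required.
  Singleton bins are feasible because each item fits together with its setup, and natural-valued
  costs attain a minimum.\<close>

lemma optimal_solution_exists:
  assumes "bpps_instance P"
  shows "\<exists>\<S>. optimal_solution P \<S>"
proof -
  let ?\<S> = "(\<lambda>i. {i}) ` items P"
  have "packing_pattern P {i}" if i: "i \<in> items P" for i
  proof -
    have "i \<in> (\<Union>c\<in>classes P. members P c)"
      using i assms by (simp add: bpps_instance_def)
    then obtain c where c: "c \<in> classes P" "i \<in> members P c" by blast
    then have "classes_of P {i} = {c}"
      using assms by (fastforce simp: classes_of_def bpps_instance_def disjoint_family_on_def)
    then show ?thesis using assms c i by (auto simp: packing_pattern_def bpps_instance_def)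
  qed
  then have "feasible_solution P ?\<S>"
    by (auto simp: feasible_solution_def partition_on_def disjoint_def)
  from ex_has_least_nat[of "feasible_solution P", OF this, of "solution_cost P"]
  show ?thesis by (auto simp: optimal_solution_def)
qed

text \<open>The sets may overlap; this is used for classes that are set up in several bins.\<close>

lemma sum_UN_le:
  fixes f :: "'a \<Rightarrow> nat"
  assumes "finite I" "\<And>i. i \<in> I \<Longrightarrow> finite (A i)"
  shows "sum f (\<Union>i\<in>I. A i) \<le> (\<Sum>i\<in>I. sum f (A i))"
  using assms
proof (induction I)
  case (insert i I)
  have "sum f (A i \<union> (\<Union>i\<in>I. A i)) \<le> sum f (A i) + sum f (\<Union>i\<in>I. A i)"
    using insert.hyps insert.prems by (subst sum_Un_nat) auto
  moreover have "sum f (\<Union>i\<in>I. A i) \<le> (\<Sum>i\<in>I. sum f (A i))"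
    using insert.IH insert.prems by blast
  ultimately show ?case using insert.hyps by simp
qed simp

text \<open>Each item is packed once and each nonempty class is set up in at least one bin, while no
  bin holds more than the capacity.\<close>

lemma total_weight_le_bins:
  assumes inst: "bpps_instance P" and feas: "feasible_solution P \<S>"
  shows "(\<Sum>i\<in>items P. item_weight P i) + (\<Sum>c\<in>classes P. setup_weight P c)
    \<le> card \<S> * capacity P"
proof -
  have part: "partition_on (items P) \<S>" and pack: "\<And>S. S \<in> \<S> \<Longrightarrow> packing_pattern P S"
    using feas by (auto simp: feasible_solution_def)
  have fin: "finite (items P)" "finite (classes P)" by (auto simp: items_def classes_def)
  have finS: "finite \<S>" using finite_elements[OF fin(1) part] .
  have U: "\<Union>\<S> = items P" using part by (auto simp: partition_on_def)
  have finE: "finite S" if "S \<in> \<S>" for S using that U fin(1) by (metis Union_upper finite_subset)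
  have "(\<Sum>i\<in>items P. item_weight P i) = (\<Sum>S\<in>\<S>. \<Sum>i\<in>S. item_weight P i)"
    unfolding U[symmetric] using finE part
    by (subst sum.Union_disjoint) (auto simp: partition_on_def disjoint_def)
  moreover have "(\<Sum>c\<in>classes P. setup_weight P c)
      \<le> (\<Sum>S\<in>\<S>. \<Sum>c\<in>classes_of P S. setup_weight P c)"
  proof -
    have "classes P \<subseteq> (\<Union>S\<in>\<S>. classes_of P S)"
    proof
      fix c assume c: "c \<in> classes P"
      then have "members P c \<noteq> {}" using inst by (simp add: bpps_instance_def)
      then obtain i where i: "i \<in> members P c" by blast
      then have "i \<in> \<Union>\<S>" using inst c U by (auto simp: bpps_instance_def)
      with i c show "c \<in> (\<Union>S\<in>\<S>. classes_of P S)" by (auto simp: classes_of_def)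
    qed
    moreover have fc: "finite (classes_of P S)" for S using fin by (simp add: classes_of_def)
    ultimately have "(\<Sum>c\<in>classes P. setup_weight P c)
        \<le> (\<Sum>c\<in>(\<Union>S\<in>\<S>. classes_of P S). setup_weight P c)"
      using finS by (intro sum_mono2) auto
    also have "\<dots> \<le> (\<Sum>S\<in>\<S>. \<Sum>c\<in>classes_of P S. setup_weight P c)"
      by (rule sum_UN_le[OF finS fc])
    finally show ?thesis .
  qed
  ultimately have "(\<Sum>i\<in>items P. item_weight P i) + (\<Sum>c\<in>classes P. setup_weight P c)
      \<le> (\<Sum>S\<in>\<S>. (\<Sum>i\<in>S. item_weight P i) + (\<Sum>c\<in>classes_of P S. setup_weight P c))"
    by (simp add: sum.distrib)
  also have "\<dots> \<le> (\<Sum>S\<in>\<S>. capacity P)"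
    using pack by (intro sum_mono) (auto simp: packing_pattern_def)
  finally show ?thesis by simp
qed

lemma lp_nat_value_le:
  assumes inst: "bpps_instance P" and k: "bin_upper_bound P k"
  shows "lp_nat_value P k \<le> ereal (real (bin_cost P) * ((\<Sum>i\<in>items P. real (item_weight P i))
      + (\<Sum>c\<in>classes P. real (setup_weight P c))) / real (capacity P)
      + (\<Sum>c\<in>classes P. real (setup_cost P c)))"
proof -
  define T where "T = (\<Sum>i\<in>items P. real (item_weight P i))
      + (\<Sum>c\<in>classes P. real (setup_weight P c))"
  \<comment> \<open>Everything is spread evenly over the \<open>k\<close> bins; the value of
    \<open>z\<close> is the smallest possible, making the capacity constraint tight.\<close>
  let ?v = "(\<lambda>i b. 1 / real k, \<lambda>c b. 1 / real k, \<lambda>b. T / (real k * real (capacity P)))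
    :: nat_vars"
  have k1: "k \<ge> 1" using k by (simp add: bin_upper_bound_def)
  have cap: "real (capacity P) > 0" using inst by (auto simp: bpps_instance_def)
  \<comment> \<open>An optimal solution uses at most \<open>k\<close> bins, so \<open>k\<close> bins
    have room for the total weight \<open>T\<close>; this yields \<open>z\<close> at most 1.\<close>
  obtain \<S> where \<S>: "optimal_solution P \<S>" using optimal_solution_exists[OF inst] by blast
  then have "(\<Sum>i\<in>items P. item_weight P i) + (\<Sum>c\<in>classes P. setup_weight P c)
      \<le> card \<S> * capacity P"
    using total_weight_le_bins[OF inst] by (auto simp: optimal_solution_def)
  also have "\<dots> \<le> k * capacity P" using k \<S> by (auto simp: bin_upper_bound_def)
  finally have "real ((\<Sum>i\<in>items P. item_weight P i) + (\<Sum>c\<in>classes P. setup_weight P c))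
      \<le> real (k * capacity P)" by (rule of_nat_mono)
  then have T: "T \<le> real k * real (capacity P)" by (simp add: T_def)
  have T0: "T \<ge> 0" by (auto simp: T_def intro!: add_nonneg_nonneg sum_nonneg)
  have "(\<Sum>i\<in>items P. real (item_weight P i) * (1 / real k))
      + (\<Sum>c\<in>classes P. real (setup_weight P c) * (1 / real k))
      = real (capacity P) * (T / (real k * real (capacity P)))"
    unfolding sum_distrib_right[symmetric] T_def using k1 cap by (simp add: field_simps)
  then have "?v \<in> lp_nat_feasible P k"
    using k1 cap T T0 by (auto simp: lp_nat_feasible_def)
  then have "lp_nat_value P k \<le> ereal (lp_nat_cost P k ?v)"
    unfolding lp_nat_value_def min_value_def by (rule INF_lower)
  also have "lp_nat_cost P k ?v = real (bin_cost P) * T / real (capacity P)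
      + (\<Sum>c\<in>classes P. real (setup_cost P c))"
    unfolding lp_nat_cost_def using k1 cap
    by (simp add: sum_divide_distrib[symmetric] field_simps)
  finally show ?thesis by (simp add: T_def)
qed

theorem proposition11:
  fixes P :: bpps and k :: nat and cs :: "nat list" and io :: "nat \<Rightarrow> nat list"
  assumes "bpps_instance P"
    and "bin_upper_bound P k"
    and "class_order P cs"
    and "item_order P io"
  shows "lp_af_value P (compressed_dag P cs io) \<ge> lp_nat_value P k"
proof -
  interpret ordered_bpps P cs io using assms by unfold_locales
  \<comment> \<open>The uniform value lies above the natural optimum and below the cost of every
    feasible flow. If there is no such flow, the infimum is infinite.\<close>
  show ?thesis
    unfolding lp_af_value_def min_value_def
    by (intro INF_greatest order_trans[OF lp_nat_value_le[OF assms(1,2)]])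
      (auto intro: lp_af_cost_ge)
qed

end
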